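(* Let $n\ge 2$ and $0\le k\le n-2$, and let $K_n$ be the complete graph on vertex set $[n]$. For $1\le j\le n-k-1$, let $\mathcal{T}^j_{n-k}$ be the set of uprooted spanning trees of $K_n$ with root $n-k$ such that the highest child of the root equals $n-k-j$. Then \[|\mathcal{T}^j_{n-k}| = n^{n-k-j-2}\,(n-1)^{k+j-2}\,(2n-k-j-1).\]
   Context: A spanning tree with a distinguished root $r$ is oriented away from $r$; the children of $r$ are its neighbours in the tree, and the highest child is the largest of them. An uprooted spanning tree with root $r$ is a spanning tree rooted at $r$ in which $r$ is greater than all of its children. *)

theory Defs
  imports Complex_Main
begin

type_synonym 'a ugraph = "'a set \<times> 'a set set"

abbreviation ugraph_verts :: "'a ugraph \<Rightarrow> 'a set" where
  "ugraph_verts G \<equiv> fst G"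

abbreviation ugraph_edges :: "'a ugraph \<Rightarrow> 'a set set" where
  "ugraph_edges G \<equiv> snd G"

definition simple_ugraph :: "'a ugraph \<Rightarrow> bool" where
  "simple_ugraph G \<longleftrightarrow> (\<forall>e\<in>ugraph_edges G. e \<subseteq> ugraph_verts G \<and> card e = 2)"

definition neighbours :: "'a ugraph \<Rightarrow> 'a \<Rightarrow> 'a set" where
  "neighbours G v = {w. {v, w} \<in> ugraph_edges G}"

definition ugraph_connected :: "'a ugraph \<Rightarrow> bool" where
  "ugraph_connected G \<longleftrightarrow> ugraph_verts G \<noteq> {} \<and>
     (\<forall>u\<in>ugraph_verts G. \<forall>v\<in>ugraph_verts G. (u, v) \<in> {(x, y). {x, y} \<in> ugraph_edges G}\<^sup>*)"

(* The vertex sequence of a cycle, with the starting vertex not repeated at the end. *)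
definition ugraph_cycle :: "'a ugraph \<Rightarrow> 'a list \<Rightarrow> bool" where
  "ugraph_cycle G vs \<longleftrightarrow> 3 \<le> length vs \<and> distinct vs \<and>
     successively (\<lambda>x y. {x, y} \<in> ugraph_edges G) vs \<and> {last vs, hd vs} \<in> ugraph_edges G"

definition ugraph_tree :: "'a ugraph \<Rightarrow> bool" where
  "ugraph_tree G \<longleftrightarrow> simple_ugraph G \<and> ugraph_connected G \<and> (\<nexists>vs. ugraph_cycle G vs)"

definition spanning_tree_of :: "'a ugraph \<Rightarrow> 'a ugraph \<Rightarrow> bool" where
  "spanning_tree_of T G \<longleftrightarrow> ugraph_tree T \<and>
     ugraph_verts T = ugraph_verts G \<and> ugraph_edges T \<subseteq> ugraph_edges G"

definition complete_ugraph :: "nat \<Rightarrow> nat ugraph" where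
  "complete_ugraph n = ({1..n}, {e. e \<subseteq> {1..n} \<and> card e = 2})"

(* A rooted tree is a pair (T, r). Since T is oriented away from r, the children of the root r
   are exactly its neighbours; children of other vertices are not needed. *)
definition rooted_spanning_tree_of :: "'a ugraph \<times> 'a \<Rightarrow> 'a ugraph \<Rightarrow> bool" where
  "rooted_spanning_tree_of R G \<longleftrightarrow> spanning_tree_of (fst R) G \<and> snd R \<in> ugraph_verts (fst R)"

definition root_children :: "'a ugraph \<times> 'a \<Rightarrow> 'a set" where
  "root_children R = neighbours (fst R) (snd R)"

(* Meaningful when the root has a child, i.e. for trees on at least two vertices. *)
definition highest_child :: "'a::linorder ugraph \<times> 'a \<Rightarrow> 'a" where
  "highest_child R = Max (root_children R)"

definition uprooted_spanning_tree_of :: "'a::linorder ugraph \<times> 'a \<Rightarrow> 'a ugraph \<Rightarrow> bool" where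
  "uprooted_spanning_tree_of R G \<longleftrightarrow>
     rooted_spanning_tree_of R G \<and> (\<forall>c\<in>root_children R. c < snd R)"

(* The set of uprooted spanning trees of the complete graph on {1..n} with root m and highest
   child m - j; used for 1 \<le> j < m, where the subtraction on nat does not truncate. *)
definition uprooted_trees :: "nat \<Rightarrow> nat \<Rightarrow> nat \<Rightarrow> (nat ugraph \<times> nat) set" where
  "uprooted_trees n m j =
     {R. uprooted_spanning_tree_of R (complete_ugraph n) \<and> snd R = m \<and> highest_child R = m - j}"

end

theory Submission
  imports Defs "HOL-Library.FuncSet"
begin

text \<open>
  Rooting a tree at \<open>r\<close> turns it into a parent map on the remaining vertices, and its acyclicity
  into the existence of a function that decreases along parents. Splitting off the set \<open>C\<close> of
  vertices whose parent is a root leaves a forest with root set \<open>C\<close> on the rest. By induction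
  this yields \<open>\<rho> (u + \<rho>) ^ (u - 1)\<close> forests on \<open>u\<close> vertices with \<open>\<rho>\<close> additional prescribed roots.
  Applied once more to trees with root \<open>n - k\<close>, with \<open>C\<close> ranging over the subsets of
  \<open>{1..h}\<close> that contain \<open>h = n - k - j\<close>, the same splitting gives the count.
\<close>

section \<open>Parent maps\<close>

text \<open>Rooted forests with root set \<open>R\<close>, encoded as extensional functions so that
  each forest is counted once. The decreasing \<open>d\<close> is only asked to exist, which
  excludes cycles without adding data to be counted.\<close>

definition parent_maps :: "'a set \<Rightarrow> 'a set \<Rightarrow> ('a \<Rightarrow> 'a) set" where
  "parent_maps U R = {p \<in> U \<rightarrow>\<^sub>E U \<union> R. \<exists>d :: 'a \<Rightarrow> nat. \<forall>u\<in>U. d (p u) < d u}"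

lemma parent_maps_decreasing:
  assumes "p \<in> parent_maps U R"
  obtains d :: "'a \<Rightarrow> nat" where "\<And>u. u \<in> U \<Longrightarrow> d (p u) < d u"
  using assms by (auto simp: parent_maps_def)

lemma parent_maps_mem: "p \<in> parent_maps U R \<Longrightarrow> u \<in> U \<Longrightarrow> p u \<in> U \<union> R"
  by (auto simp: parent_maps_def)

lemma finite_parent_maps: "finite U \<Longrightarrow> finite R \<Longrightarrow> finite (parent_maps U R)"
  by (rule finite_subset[of _ "U \<rightarrow>\<^sub>E U \<union> R"]) (auto simp: parent_maps_def intro: finite_PiE)

text \<open>A vertex of \<open>U\<close> with least \<open>d\<close> cannot have its parent in
  \<open>U\<close>. This makes \<open>parent_maps U {}\<close> empty for nonempty \<open>U\<close>,
  and later gives the root of a tree a child.\<close>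

lemma parent_maps_root_child:
  assumes "p \<in> parent_maps U R" "U \<noteq> {}"
  shows "\<exists>u\<in>U. p u \<in> R"
proof -
  obtain d :: "'a \<Rightarrow> nat" where d: "\<And>u. u \<in> U \<Longrightarrow> d (p u) < d u"
    by (rule parent_maps_decreasing[OF assms(1)]) blast
  obtain u where u: "u \<in> U" "\<forall>v. v \<in> U \<longrightarrow> d u \<le> d v"
    using ex_has_least_nat[of "\<lambda>u. u \<in> U" _ d] assms(2) by blast
  then show ?thesis using d[of u] parent_maps_mem[OF assms(1), of u]
    by (meson UnE leD)
qed

text \<open>Vertices of \<open>C\<close> choose parents in \<open>R\<close> freely; any other vertex
  has its parent in \<open>U\<close>, so the rest is a forest rooted at \<open>C\<close>. Gluing
  inverts this, since disjointness of \<open>U\<close> and \<open>R\<close> makes \<open>C\<close>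
  recoverable. The family \<open>\<A>\<close> allows constraints on the set of root
  children.\<close>

lemma bij_betw_parent_maps_Sigma:
  assumes "U \<inter> R = {}" "\<A> \<subseteq> Pow U"
  shows "bij_betw (\<lambda>p. ({u\<in>U. p u \<in> R}, restrict p {u\<in>U. p u \<in> R}, restrict p {u\<in>U. p u \<notin> R}))
     {p \<in> parent_maps U R. {u\<in>U. p u \<in> R} \<in> \<A>}
     (SIGMA C:\<A>. (C \<rightarrow>\<^sub>E R) \<times> parent_maps (U - C) C)"
    (is "bij_betw ?split ?P ?S")
proof (rule bij_betw_byWitness[where f' = "\<lambda>(C, g, q) u. if u \<in> C then g u else q u"], goal_cases)
  case 1
  show ?case
  proof (rule ballI)
    fix p assume "p \<in> ?P"
    then have "p u = undefined" if "u \<notin> U" for u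
      using that by (auto simp: parent_maps_def PiE_def extensional_def)
    then show "(\<lambda>(C, g, q) u. if u \<in> C then g u else q u) (?split p) = p"
      by (simp add: fun_eq_iff)
  qed
next
  case 2
  show ?case
  proof (rule ballI)
    fix z assume "z \<in> ?S"
    then obtain C g q where z: "z = (C, g, q)"
      and C: "C \<in> \<A>" and g: "g \<in> C \<rightarrow>\<^sub>E R" and q: "q \<in> parent_maps (U - C) C"
      by blast
    have qU: "q u \<in> U" if "u \<in> U - C" for u
      using parent_maps_mem[OF q that] C assms(2) by auto
    have eq: "{u\<in>U. (if u \<in> C then g u else q u) \<in> R} = C"
      "{u\<in>U. (if u \<in> C then g u else q u) \<notin> R} = U - C"
      using g qU assms C by (auto split: if_splits)
    have "restrict (\<lambda>u. if u \<in> C then g u else q u) C = g"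
      using g by (auto simp: fun_eq_iff restrict_def PiE_def extensional_def)
    moreover have "restrict (\<lambda>u. if u \<in> C then g u else q u) (U - C) = q"
      using q by (auto simp: fun_eq_iff restrict_def PiE_def extensional_def parent_maps_def)
    ultimately show "?split ((\<lambda>(C, g, q) u. if u \<in> C then g u else q u) z) = z"
      by (simp add: eq z)
  qed
next
  case 3
  show ?case
  proof (rule image_subsetI)
    fix p assume "p \<in> ?P"
    then have p: "p \<in> parent_maps U R" and C: "{u\<in>U. p u \<in> R} \<in> \<A>" by auto
    obtain d :: "'a \<Rightarrow> nat" where d: "\<And>u. u \<in> U \<Longrightarrow> d (p u) < d u"
      by (rule parent_maps_decreasing[OF p]) blast
    have eq: "{u\<in>U. p u \<notin> R} = U - {u\<in>U. p u \<in> R}" "U - {u\<in>U. p u \<in> R} \<union> {u\<in>U. p u \<in> R} = U"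
      by auto
    have "p u \<in> U" if "u \<in> U - {u\<in>U. p u \<in> R}" for u
      using parent_maps_mem[OF p, of u] that by auto
    then have "restrict p {u\<in>U. p u \<notin> R} \<in> parent_maps (U - {u\<in>U. p u \<in> R}) {u\<in>U. p u \<in> R}"
      unfolding parent_maps_def eq using d by (auto simp: restrict_PiE_iff)
    then show "?split p \<in> ?S" using C by auto
  qed
next
  case 4
  show ?case
  proof (rule image_subsetI)
    fix z assume "z \<in> ?S"
    then obtain C g q where z: "z = (C, g, q)"
      and C: "C \<in> \<A>" and g: "g \<in> C \<rightarrow>\<^sub>E R" and q: "q \<in> parent_maps (U - C) C"
      by blast
    obtain d :: "'a \<Rightarrow> nat" where d: "\<And>u. u \<in> U - C \<Longrightarrow> d (q u) < d u"
      by (rule parent_maps_decreasing[OF q]) blast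
    define p where "p = (\<lambda>u. if u \<in> C then g u else q u)"
    have qU: "q u \<in> U" if "u \<in> U - C" for u
      using parent_maps_mem[OF q that] C assms(2) by auto
    have "{u\<in>U. p u \<in> R} = C"
      using g qU assms C by (auto simp: p_def split: if_splits)
    moreover have "p \<in> U \<rightarrow>\<^sub>E U \<union> R"
    proof (rule PiE_I)
      show "p u \<in> U \<union> R" if "u \<in> U" for u
        using that g qU by (auto simp: p_def dest: PiE_mem)
      show "p u = undefined" if "u \<notin> U" for u
        using that q C assms(2) by (auto simp: p_def parent_maps_def dest: PiE_arb)
    qed
    moreover have "\<exists>d :: 'a \<Rightarrow> nat. \<forall>u\<in>U. d (p u) < d u"
    proof (intro exI ballI)
      \<comment> \<open>The new witness is 0 on \<open>R\<close> and \<open>d\<close> raised by one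
        elsewhere: steps into \<open>R\<close> decrease it, and so do the steps from
        \<open>U - C\<close>, which stay in \<open>U\<close>.\<close>
      show "(if p u \<in> R then 0 else Suc (d (p u))) < (if u \<in> R then 0 else Suc (d u))" if "u \<in> U" for u
        using that g qU[of u] d[of u] assms(1) by (auto simp: p_def dest: PiE_mem)
    qed
    ultimately have "p \<in> {p \<in> parent_maps U R. {u\<in>U. p u \<in> R} \<in> \<A>}"
      using C by (simp add: parent_maps_def)
    then show "(\<lambda>(C, g, q) u. if u \<in> C then g u else q u) z \<in> ?P"
      by (simp add: p_def z)
  qed
qed

lemma card_parent_maps_by_root_children:
  assumes "finite U" "finite R" "U \<inter> R = {}" "\<A> \<subseteq> Pow U"
  shows "card {p \<in> parent_maps U R. {u\<in>U. p u \<in> R} \<in> \<A>} =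
    (\<Sum>C\<in>\<A>. card R ^ card C * card (parent_maps (U - C) C))"
proof -
  have fin: "finite \<A>" "\<And>C. C \<in> \<A> \<Longrightarrow> finite C"
    using assms by (auto intro: finite_subset)
  have "card {p \<in> parent_maps U R. {u\<in>U. p u \<in> R} \<in> \<A>} =
      card (SIGMA C:\<A>. (C \<rightarrow>\<^sub>E R) \<times> parent_maps (U - C) C)"
    by (rule bij_betw_same_card[OF bij_betw_parent_maps_Sigma[OF assms(3,4)]])
  also have "\<dots> = (\<Sum>C\<in>\<A>. card ((C \<rightarrow>\<^sub>E R) \<times> parent_maps (U - C) C))"
    using assms fin by (intro card_SigmaI) (auto intro!: finite_PiE finite_parent_maps)
  also have "\<dots> = (\<Sum>C\<in>\<A>. card R ^ card C * card (parent_maps (U - C) C))"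
    using fin by (intro sum.cong) (auto simp: card_cartesian_product card_PiE)
  finally show ?thesis .
qed

section \<open>Binomial sums and the number of forests\<close>

lemma sum_Pow_card:
  fixes f :: "nat \<Rightarrow> 'b::comm_semiring_1"
  assumes "finite A"
  shows "(\<Sum>C\<in>Pow A. f (card C)) = (\<Sum>i\<le>card A. of_nat (card A choose i) * f i)"
proof -
  have "(\<Sum>C\<in>Pow A. f (card C)) = (\<Sum>i\<le>card A. \<Sum>C\<in>{C\<in>Pow A. card C = i}. f (card C))"
    using assms by (intro sum.group[symmetric]) (auto intro: card_mono)
  also have "\<dots> = (\<Sum>i\<le>card A. of_nat (card A choose i) * f i)"
    using assms by (intro sum.cong) (auto simp: n_subsets)
  finally show ?thesis .
qed

text \<open>The term at 0 vanishes; for the others, absorption of \<open>i\<close> into the binomial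
  coefficient gives \<open>s\<close> times a coefficient of \<open>s - 1\<close>, and the binomial
  theorem applies. For \<open>s = 0\<close> both sides are 0.\<close>

lemma binomial_moment:
  fixes x y :: "'b::comm_semiring_1"
  shows "(\<Sum>i\<le>s. of_nat (s choose i) * (of_nat i * x ^ i * y ^ (s - i))) = of_nat s * x * (x + y) ^ (s - 1)"
proof (cases s)
  case (Suc t)
  have "(\<Sum>i\<le>s. of_nat (s choose i) * (of_nat i * x ^ i * y ^ (s - i))) =
      (\<Sum>i\<le>t. of_nat (Suc i * (Suc t choose Suc i)) * x ^ Suc i * y ^ (t - i))"
    unfolding Suc sum.atMost_Suc_shift by (simp add: algebra_simps del: binomial_Suc_Suc power_Suc)
  also have "\<dots> = (\<Sum>i\<le>t. of_nat s * x * (of_nat (t choose i) * x ^ i * y ^ (t - i)))"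
    by (simp only: Suc_times_binomial Suc of_nat_mult) (simp add: mult_ac del: of_nat_Suc)
  also have "\<dots> = of_nat s * x * (x + y) ^ (s - 1)"
    by (simp add: Suc binomial_ring sum_distrib_left)
  finally show ?thesis .
qed simp

text \<open>Multiplied out, so that the exponent does not truncate when \<open>U\<close> is empty.\<close>

lemma card_parent_maps_mult:
  assumes "finite U" "finite R" "U \<inter> R = {}"
  shows "(card U + card R) * card (parent_maps U R) = card R * (card U + card R) ^ card U"
  using assms
proof (induction "card U" arbitrary: U R rule: less_induct)
  case less
  show ?case
  proof (cases "U = {}")
    case True
    then show ?thesis by (simp add: parent_maps_def)
  next
    case False
    let ?u = "card U" and ?r = "card R"
    have u: "?u > 0" using False less.prems by (simp add: card_gt_0_iff)
    \<comment> \<open>A forest on \<open>U - C\<close> with roots \<open>C\<close> has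
      \<open>?u\<close> vertices in all, so \<open>?u\<close> is the very factor that the induction
      hypothesis carries.\<close>
    have *: "?u * (?r ^ card C * card (parent_maps (U - C) C)) = card C * ?r ^ card C * ?u ^ (?u - card C)"
      if "C \<in> Pow U" for C
    proof (cases "C = {}")
      case True
      \<comment> \<open>Here \<open>U - C\<close> is not smaller than \<open>U\<close>, so the
        induction hypothesis does not apply, but both sides are 0.\<close>
      have "parent_maps U {} = {}" using parent_maps_root_child[of _ U "{}"] False by blast
      with True show ?thesis by simp
    next
      case nonempty: False
      have fin: "finite C" "C \<subseteq> U" using that less.prems by (auto intro: finite_subset)
      then have diff: "card (U - C) = ?u - card C" by (simp add: card_Diff_subset)
      have le: "card C \<le> ?u" using fin less.prems by (simp add: card_mono)
      have "card C > 0" using fin nonempty by (simp add: card_gt_0_iff)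
      then have "(card (U - C) + card C) * card (parent_maps (U - C) C) =
          card C * (card (U - C) + card C) ^ card (U - C)"
        using u fin less.prems diff by (intro less.hyps) auto
      then show ?thesis using diff le by simp
    qed
    have "?u * card (parent_maps U R) =
        ?u * card {p \<in> parent_maps U R. {u\<in>U. p u \<in> R} \<in> Pow U}"
      by (rule arg_cong[where f = "\<lambda>A. ?u * card A"]) auto
    also have "\<dots> = (\<Sum>C\<in>Pow U. card C * ?r ^ card C * ?u ^ (?u - card C))"
      by (simp only: card_parent_maps_by_root_children[OF less.prems order_refl] sum_distrib_left)
        (intro sum.cong refl *)
    also have "\<dots> = (\<Sum>i\<le>?u. (?u choose i) * (i * ?r ^ i * ?u ^ (?u - i)))"
      using sum_Pow_card[OF less.prems(1), of "\<lambda>i. i * ?r ^ i * ?u ^ (?u - i)"] by simp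
    also have "\<dots> = ?u * (?r * (?r + ?u) ^ (?u - 1))"
      using binomial_moment[of ?u ?r ?u] by simp
    finally have "card (parent_maps U R) = ?r * (?r + ?u) ^ (?u - 1)"
      using u by (metis mult_left_cancel less_numeral_extra(3))
    then show ?thesis
      using u by (simp add: power_eq_if[of _ ?u] add_ac mult_ac)
  qed
qed

section \<open>Trees as parent maps\<close>

text \<open>The walk is built from its end; when the vertex to prepend already occurs, the suffix
  starting there is taken instead.\<close>

lemma rtrancl_distinct_walk:
  assumes "(a, b) \<in> {(x, y). P x y}\<^sup>*"
  shows "\<exists>vs. vs \<noteq> [] \<and> hd vs = a \<and> last vs = b \<and> distinct vs \<and> successively P vs"
  using assms
proof (induction rule: converse_rtrancl_induct)
  case base
  show ?case by (intro exI[of _ "[b]"]) simp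
next
  case (step x y)
  then obtain vs where vs: "vs \<noteq> []" "hd vs = y" "last vs = b" "distinct vs" "successively P vs"
    by blast
  show ?case
  proof (cases "x \<in> set vs")
    case True
    then obtain xs ys where "vs = xs @ x # ys" by (auto dest: split_list)
    with vs show ?thesis by (intro exI[of _ "x # ys"]) (auto simp: successively_append_iff)
  next
    case False
    with vs step show ?thesis
      by (intro exI[of _ "x # vs"]) (auto simp: successively_Cons)
  qed
qed

definition parent_edges :: "'a set \<Rightarrow> ('a \<Rightarrow> 'a) \<Rightarrow> 'a set set" where
  "parent_edges U p = (\<lambda>u. {u, p u}) ` U"

lemma parent_edges_iff: "{x, y} \<in> parent_edges U p \<longleftrightarrow> x \<in> U \<and> y = p x \<or> y \<in> U \<and> x = p y"
  by (auto simp: parent_edges_def doubleton_eq_iff)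

text \<open>Moving to the parent lowers \<open>d\<close> and can only stop at \<open>r\<close>; by
  symmetry of the edge relation any two vertices are joined through \<open>r\<close>.\<close>

lemma parent_edges_connected:
  assumes p: "p \<in> parent_maps U {r}"
  shows "ugraph_connected (insert r U, parent_edges U p)"
proof -
  let ?E = "{(x, y). {x, y} \<in> parent_edges U p}"
  obtain d :: "'a \<Rightarrow> nat" where d: "\<And>u. u \<in> U \<Longrightarrow> d (p u) < d u"
    by (rule parent_maps_decreasing[OF p]) blast
  have root: "(u, r) \<in> ?E\<^sup>*" if "u \<in> insert r U" for u
    using that
  proof (induction "d u" arbitrary: u rule: less_induct)
    case less
    show ?case
    proof (cases "u = r")
      case False
      then have u: "u \<in> U" using less.prems by simp
      then have "(p u, r) \<in> ?E\<^sup>*"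
        using d parent_maps_mem[OF p] by (intro less.hyps) auto
      then show ?thesis
        using u by (intro converse_rtrancl_into_rtrancl[of u "p u"]) (auto simp: parent_edges_iff)
    qed simp
  qed
  have "sym ?E" by (auto simp: sym_def insert_commute)
  then have "sym (?E\<^sup>*)" by (rule sym_rtrancl)
  then show ?thesis
    using root unfolding ugraph_connected_def
    by (auto dest: symD intro: rtrancl_trans)
qed

text \<open>Take a vertex of maximal \<open>d\<close> on a cycle. A neighbour on the cycle cannot be
  its child, so both cyclic neighbours equal its parent, although they are distinct.\<close>

lemma parent_edges_acyclic:
  assumes p: "p \<in> parent_maps U R"
  shows "\<not> ugraph_cycle (V, parent_edges U p) vs"
proof
  assume "ugraph_cycle (V, parent_edges U p) vs"
  then have len: "3 \<le> length vs" and dist: "distinct vs"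
    and succ: "successively (\<lambda>x y. {x, y} \<in> parent_edges U p) vs"
    and close: "{last vs, hd vs} \<in> parent_edges U p"
    by (auto simp: ugraph_cycle_def)
  obtain d :: "'a \<Rightarrow> nat" where d: "\<And>u. u \<in> U \<Longrightarrow> d (p u) < d u"
    by (rule parent_maps_decreasing[OF p]) blast
  let ?l = "length vs"
  have edge: "{vs ! i, vs ! (Suc i mod ?l)} \<in> parent_edges U p" if "i < ?l" for i
  proof (cases "Suc i = ?l")
    case True
    then have "i = ?l - 1" by simp
    then show ?thesis using close True len
      by (metis Suc_leI hd_conv_nth last_conv_nth length_0_conv mod_self not_numeral_le_zero)
  next
    case False
    then show ?thesis using that succ by (simp add: successively_conv_nth)
  qed
  have "Max (d ` set vs) \<in> d ` set vs"
    using len by (intro Max_in) auto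
  then obtain i where i: "i < ?l" "Max (d ` set vs) = d (vs ! i)"
    by (auto simp: in_set_conv_nth)
  have max: "d v \<le> d (vs ! i)" if "v \<in> set vs" for v
    using that i(2) by (metis Max_ge List.finite_set finite_imageI imageI)
  have parent: "v = p (vs ! i)" if "v \<in> set vs" "{vs ! i, v} \<in> parent_edges U p" for v
    using that(2) max[OF that(1)] d[of v] by (auto simp: parent_edges_iff)
  \<comment> \<open>The cyclic successor and predecessor of \<open>i\<close>; they differ because
    the cycle has at least three vertices.\<close>
  define a where "a = Suc i mod ?l"
  define b where "b = (if i = 0 then ?l - 1 else i - 1)"
  have b: "b < ?l" "Suc b mod ?l = i" using i len by (auto simp: b_def)
  have a: "a < ?l" using len unfolding a_def by (intro mod_less_divisor) linarith
  have "a \<noteq> b" using i len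
    by (cases "Suc i = ?l") (auto simp: a_def b_def split: if_splits)
  have "vs ! a = p (vs ! i)"
    using edge[OF i(1)] a by (intro parent) (auto simp: a_def)
  moreover have "vs ! b = p (vs ! i)"
    using edge[OF b(1)] b by (intro parent) (auto simp: insert_commute)
  ultimately show False
    using \<open>a \<noteq> b\<close> a b(1) dist by (metis nth_eq_iff_index_eq)
qed

lemma parent_edges_tree:
  assumes p: "p \<in> parent_maps U {r}"
  shows "ugraph_tree (insert r U, parent_edges U p)"
proof -
  obtain d :: "'a \<Rightarrow> nat" where d: "\<And>u. u \<in> U \<Longrightarrow> d (p u) < d u"
    by (rule parent_maps_decreasing[OF p]) blast
  \<comment> \<open>The decrease of \<open>d\<close> rules out \<open>p u = u\<close>, so each edge
    has two ends.\<close>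
  have "simple_ugraph (insert r U, parent_edges U p)"
    using parent_maps_mem[OF p] d
    by (fastforce simp: simple_ugraph_def parent_edges_def card_2_iff)
  then show ?thesis
    using parent_edges_connected[OF p] parent_edges_acyclic[OF p] by (auto simp: ugraph_tree_def)
qed

text \<open>The root fixes the orientation of every edge. If \<open>q\<close> oriented
  \<open>{u, p u}\<close> the other way, then \<open>q (p u) = u\<close>; induction on
  \<open>d\<close> turns this into \<open>p (p u) = u\<close>, against the decrease of
  \<open>d\<close>.\<close>

lemma parent_edges_inj:
  assumes "r \<notin> U"
  shows "inj_on (parent_edges U) (parent_maps U {r})"
proof (rule inj_onI)
  fix p q
  assume p: "p \<in> parent_maps U {r}" and q: "q \<in> parent_maps U {r}"
    and eq: "parent_edges U p = parent_edges U q"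
  obtain d :: "'a \<Rightarrow> nat" where d: "\<And>u. u \<in> U \<Longrightarrow> d (p u) < d u"
    by (rule parent_maps_decreasing[OF p]) blast
  have "p u = q u" if "u \<in> U" for u
    using that
  proof (induction "d u" arbitrary: u rule: less_induct)
    case less
    have "{u, p u} \<in> parent_edges U q"
      using less.prems eq by (auto simp: parent_edges_def)
    then consider "p u = q u" | "p u \<in> U" "u = q (p u)"
      by (auto simp: parent_edges_iff)
    then show ?case
    proof cases
      case 2
      then have "p (p u) = u" using less.hyps[of "p u"] d less.prems by simp
      then show ?thesis using d[of u] d[of "p u"] less.prems 2 by simp
    qed
  qed
  then show "p = q"
    using p q by (auto simp: parent_maps_def intro: PiE_ext)
qed

text \<open>Let each vertex point to a neighbour closer to the root. The resulting edges already
  connect everything, so any further edge of the tree would close a cycle.\<close>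

lemma tree_is_parent_edges:
  assumes T: "ugraph_tree (insert r U, E)" and "r \<notin> U"
  shows "E \<in> parent_edges U ` parent_maps U {r}"
proof -
  let ?E = "{(x, y). {x, y} \<in> E}"
  have simple: "\<And>e. e \<in> E \<Longrightarrow> e \<subseteq> insert r U \<and> card e = 2"
    and conn: "\<And>u. u \<in> U \<Longrightarrow> (u, r) \<in> ?E\<^sup>*"
    and acyc: "\<And>vs. \<not> ugraph_cycle (insert r U, E) vs"
    using T by (auto simp: ugraph_tree_def simple_ugraph_def ugraph_connected_def)
  \<comment> \<open>The distance to \<open>r\<close>; connectedness ensures that it is attained on
    \<open>U\<close>.\<close>
  define d where "d u = (LEAST n. (u, r) \<in> ?E ^^ n)" for u
  have closer: "\<exists>v. {u, v} \<in> E \<and> d v < d u" if "u \<in> U" for u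
  proof -
    have "\<exists>n. (u, r) \<in> ?E ^^ n" using conn[OF that] by (simp add: rtrancl_power)
    then have du: "(u, r) \<in> ?E ^^ d u" unfolding d_def by (rule LeastI_ex)
    moreover have "u \<noteq> r" using that assms(2) by auto
    ultimately obtain n where n: "d u = Suc n" by (cases "d u") auto
    then obtain v where "{u, v} \<in> E" "(v, r) \<in> ?E ^^ n"
      using du unfolding n by (blast dest: relpow_Suc_D2)
    then have "d v \<le> n" unfolding d_def by (intro Least_le)
    with n \<open>{u, v} \<in> E\<close> show ?thesis by auto
  qed
  define p where "p = restrict (\<lambda>u. SOME v. {u, v} \<in> E \<and> d v < d u) U"
  have pE: "{u, p u} \<in> E" and pd: "d (p u) < d u" if "u \<in> U" for u
    using someI_ex[OF closer[OF that]] that by (auto simp: p_def)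
  have p: "p \<in> parent_maps U {r}"
    using pd simple[OF pE] by (auto simp: parent_maps_def p_def)
  have sub: "parent_edges U p \<subseteq> E" using pE by (auto simp: parent_edges_def)
  have "E \<subseteq> parent_edges U p"
  proof
    fix e assume e: "e \<in> E"
    obtain a b where ab: "e = {a, b}" "a \<noteq> b" "a \<in> insert r U" "b \<in> insert r U"
      using simple[OF e] by (auto simp: card_2_iff)
    have "(a, b) \<in> {(x, y). {x, y} \<in> parent_edges U p}\<^sup>*"
      using parent_edges_connected[OF p] ab unfolding ugraph_connected_def by auto
    then obtain vs where vs: "vs \<noteq> []" "hd vs = a" "last vs = b" "distinct vs"
        "successively (\<lambda>x y. {x, y} \<in> parent_edges U p) vs"
      using rtrancl_distinct_walk[of a b "\<lambda>x y. {x, y} \<in> parent_edges U p"] by blast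
    have "successively (\<lambda>x y. {x, y} \<in> E) vs"
      using vs(5) by (rule successively_mono) (use sub in auto)
    \<comment> \<open>With three or more vertices, \<open>vs\<close> together with \<open>e\<close>
      would be a cycle in the tree. Since \<open>a\<close> and \<open>b\<close> differ,
      \<open>vs\<close> is then just \<open>[a, b]\<close>.\<close>
    then have short: "length vs < 3"
      using acyc[of vs] vs e ab by (auto simp: ugraph_cycle_def insert_commute)
    obtain x xs where x: "vs = x # xs" using vs(1) by (cases vs) auto
    with vs ab obtain y ys where "xs = y # ys" by (cases xs) auto
    with short x have "vs = [x, y]" by auto
    with vs ab show "e \<in> parent_edges U p" by auto
  qed
  with sub p show ?thesis by blast
qed

section \<open>Uprooted trees\<close>

text \<open>The children of the root are the vertices with parent \<open>m\<close>. Having maximum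
  \<open>m - j\<close> means containing \<open>m - j\<close> and nothing larger; as
  \<open>m - j < m\<close>, such trees are automatically uprooted.\<close>

lemma uprooted_trees_eq_image:
  assumes "1 \<le> j" "j < m" "m \<le> n"
  shows "uprooted_trees n m j = (\<lambda>p. (({1..n}, parent_edges ({1..n} - {m}) p), m)) `
    {p \<in> parent_maps ({1..n} - {m}) {m}.
      {u \<in> {1..n} - {m}. p u \<in> {m}} \<in> insert (m - j) ` Pow {1..<m - j}}"
    (is "_ = ?t ` ?P")
proof -
  let ?U = "{1..n} - {m}"
  have V: "insert m ?U = {1..n}" using assms by auto
  have mem: "?t p \<in> uprooted_trees n m j \<longleftrightarrow>
      {u \<in> ?U. p u \<in> {m}} \<in> insert (m - j) ` Pow {1..<m - j}"
    if p: "p \<in> parent_maps ?U {m}" for p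
  proof -
    let ?C = "{u \<in> ?U. p u \<in> {m}}"
    have tree: "ugraph_tree ({1..n}, parent_edges ?U p)"
      using parent_edges_tree[OF p] by (simp only: V)
    then have "spanning_tree_of ({1..n}, parent_edges ?U p) (complete_ugraph n)"
      by (auto simp: spanning_tree_of_def complete_ugraph_def ugraph_tree_def simple_ugraph_def)
    moreover have children: "root_children (?t p) = ?C"
      by (auto simp: root_children_def neighbours_def parent_edges_iff)
    ultimately have iff: "?t p \<in> uprooted_trees n m j \<longleftrightarrow> (\<forall>c\<in>?C. c < m) \<and> Max ?C = m - j"
      using assms by (simp add: uprooted_trees_def uprooted_spanning_tree_of_def
          rooted_spanning_tree_of_def highest_child_def)
    \<comment> \<open>A vertex other than \<open>m\<close> exists, hence the root has a child and
      \<open>Max\<close> is taken over a nonempty set.\<close>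
    have "(if m = 1 then 2 else 1) \<in> ?U" using assms by auto
    then have "?U \<noteq> {}" by blast
    then have "?C \<noteq> {}" using parent_maps_root_child[OF p] by blast
    then have Max: "Max ?C = m - j \<longleftrightarrow> m - j \<in> ?C \<and> (\<forall>c\<in>?C. c \<le> m - j)"
      by (intro Max_eq_iff) simp_all
    show ?thesis
    proof
      assume "?t p \<in> uprooted_trees n m j"
      then have C: "m - j \<in> ?C" "\<forall>c\<in>?C. c \<le> m - j" using iff Max by auto
      then have "?C - {m - j} \<subseteq> {1..<m - j}" by (auto simp: order.strict_iff_order)
      moreover have "?C = insert (m - j) (?C - {m - j})" using C(1) by (rule insert_Diff[symmetric])
      ultimately show "?C \<in> insert (m - j) ` Pow {1..<m - j}" by blast
    next
      assume "?C \<in> insert (m - j) ` Pow {1..<m - j}"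
      then obtain D where D: "D \<subseteq> {1..<m - j}" "?C = insert (m - j) D" by auto
      have "\<forall>c\<in>?C. c \<le> m - j" "m - j \<in> ?C" unfolding D(2) using D(1) by auto
      moreover have "m - j < m" using assms by simp
      ultimately show "?t p \<in> uprooted_trees n m j" unfolding iff Max by (meson le_less_trans)
    qed
  qed
  have "uprooted_trees n m j \<subseteq> ?t ` parent_maps ?U {m}"
  proof
    fix R assume R: "R \<in> uprooted_trees n m j"
    obtain V E r where Rt: "R = ((V, E), r)" by (metis surj_pair)
    with R have "ugraph_tree (insert m ?U, E)" and eq: "V = {1..n}" "r = m"
      by (simp_all only: V)
        (auto simp: uprooted_trees_def uprooted_spanning_tree_of_def
          rooted_spanning_tree_of_def spanning_tree_of_def complete_ugraph_def)
    then have "E \<in> parent_edges ?U ` parent_maps ?U {m}"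
      by (intro tree_is_parent_edges) auto
    then show "R \<in> ?t ` parent_maps ?U {m}" using Rt eq by auto
  qed
  then have "uprooted_trees n m j = ?t ` {p \<in> parent_maps ?U {m}. ?t p \<in> uprooted_trees n m j}"
    by blast
  also have "{p \<in> parent_maps ?U {m}. ?t p \<in> uprooted_trees n m j} = ?P"
    by (intro Collect_cong conj_cong refl mem)
  finally show ?thesis .
qed

text \<open>The factors \<open>n - 1\<close> and \<open>n\<close> keep all exponents natural: the
  first is the one in the forest count with \<open>n - 1\<close> vertices, the second lifts the
  power \<open>s - 1\<close> coming from \<open>binomial_moment\<close>.\<close>

lemma card_uprooted_trees:
  assumes "1 \<le> j" "j < m" "m \<le> n"
  shows "(n - 1) * n * card (uprooted_trees n m j) =
    (n - 1) ^ (n - 1 - (m - j)) * n ^ (m - j - 1) * (n + (m - j) - 1)"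
proof -
  let ?U = "{1..n} - {m}"
  \<comment> \<open>\<open>N\<close> counts the vertices other than the root, \<open>h\<close> is
    the highest child, and \<open>s\<close> counts the smaller vertices that may also be
    children.\<close>
  define N h where "N = n - 1" and "h = m - j"
  define s where "s = h - 1"
  have n: "n = Suc N" and h: "h = Suc s" "h \<le> N" using assms by (auto simp: N_def h_def s_def)
  have cU: "card ?U = N" using assms by (simp add: N_def)
  have "h \<in> ?U" and sub: "{1..<h} \<subseteq> ?U" using assms by (auto simp: h_def)
  define \<A> where "\<A> = insert h ` Pow {1..<h}"
  have \<A>: "\<A> \<subseteq> Pow ?U" using \<open>h \<in> ?U\<close> sub by (auto simp: \<A>_def)
  have inj: "inj_on (insert h) (Pow {1..<h})"
    by (rule inj_onI) (metis Diff_insert_absorb PowD atLeastLessThan_iff less_irrefl subsetD insert_Diff_single)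
  have "inj_on (\<lambda>p. (({1..n}, parent_edges ?U p), m)) (parent_maps ?U {m})"
    using parent_edges_inj[of m ?U] by (auto simp: inj_on_def)
  then have "card (uprooted_trees n m j) = card {p \<in> parent_maps ?U {m}. {u \<in> ?U. p u \<in> {m}} \<in> \<A>}"
    unfolding uprooted_trees_eq_image[OF assms] \<A>_def h_def
    by (intro card_image) (rule inj_on_subset, auto)
  also have "\<dots> = (\<Sum>C\<in>\<A>. card (parent_maps (?U - C) C))"
    using card_parent_maps_by_root_children[of ?U "{m}" \<A>] \<A> by simp
  finally have "N * card (uprooted_trees n m j) = (\<Sum>C\<in>\<A>. N * card (parent_maps (?U - C) C))"
    by (simp add: sum_distrib_left)
  also have "\<dots> = (\<Sum>C\<in>\<A>. card C * N ^ (N - card C))"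
  proof (rule sum.cong)
    fix C assume "C \<in> \<A>"
    then have C: "C \<subseteq> ?U" using \<A> by auto
    then have fin: "finite C" by (rule finite_subset) simp
    have le: "card C \<le> N" using C cU by (metis card_mono finite_Diff finite_atLeastAtMost)
    have diff: "card (?U - C) = N - card C" using fin C cU by (simp only: card_Diff_subset)
    show "N * card (parent_maps (?U - C) C) = card C * N ^ (N - card C)"
      using card_parent_maps_mult[of "?U - C" C] fin le diff by auto
  qed simp
  also have "\<dots> = (\<Sum>D\<in>Pow {1..<h}. card (insert h D) * N ^ (N - card (insert h D)))"
    unfolding \<A>_def by (subst sum.reindex[OF inj]) simp
  also have "\<dots> = (\<Sum>D\<in>Pow {1..<h}. (\<lambda>i. Suc i * N ^ (N - Suc i)) (card D))"
  proof (rule sum.cong)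
    fix D assume "D \<in> Pow {1..<h}"
    then have "finite D" "h \<notin> D" by (auto intro: finite_subset)
    then show "card (insert h D) * N ^ (N - card (insert h D)) = (\<lambda>i. Suc i * N ^ (N - Suc i)) (card D)"
      by simp
  qed simp
  also have "\<dots> = (\<Sum>i\<le>s. (s choose i) * (Suc i * N ^ (N - Suc i)))"
    by (subst sum_Pow_card) (simp_all add: s_def)
  \<comment> \<open>Writing \<open>Suc i\<close> as \<open>i + 1\<close> separates a binomial moment
    from a plain binomial sum; the powers of 1 bring both into the shape of the lemmas used
    next.\<close>
  also have "\<dots> = (\<Sum>i\<le>s. N ^ (N - h) * ((s choose i) * (i * 1 ^ i * N ^ (s - i)) + (s choose i) * 1 ^ i * N ^ (s - i)))"
  proof (rule sum.cong)
    fix i assume "i \<in> {..s}"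
    then have "N - Suc i = (N - h) + (s - i)" using h by auto
    then show "(s choose i) * (Suc i * N ^ (N - Suc i)) = N ^ (N - h) *
      ((s choose i) * (i * 1 ^ i * N ^ (s - i)) + (s choose i) * 1 ^ i * N ^ (s - i))"
      by (simp add: power_add algebra_simps)
  qed simp
  also have "\<dots> = N ^ (N - h) * (s * n ^ (s - 1) + n ^ s)"
    using binomial_moment[of s 1 N] binomial[of 1 N s]
    by (simp only: sum_distrib_left[symmetric] sum.distrib) (simp add: n)
  finally have "n * (N * card (uprooted_trees n m j)) = N ^ (N - h) * (s * (n * n ^ (s - 1)) + n * n ^ s)"
    by (simp add: algebra_simps)
  \<comment> \<open>For \<open>s = 0\<close> the exponent truncates, but the factor \<open>s\<close>
    makes both sides 0.\<close>
  also have "s * (n * n ^ (s - 1)) = s * n ^ s" by (cases s) auto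
  finally have "n * (N * card (uprooted_trees n m j)) = N ^ (N - h) * n ^ s * (s + n)"
    by (simp add: algebra_simps)
  moreover have "n + h - 1 = s + n" using h by simp
  ultimately show ?thesis
    by (simp only: N_def[symmetric] h_def[symmetric] s_def[symmetric] mult_ac)
qed

theorem theorem4p1:
  fixes n k j :: nat
  assumes "2 \<le> n" and "k \<le> n - 2" and "1 \<le> j" and "j \<le> n - k - 1"
  shows "real (card (uprooted_trees n (n - k) j)) =
           real n powi (int n - int k - int j - 2) *
           (real n - 1) powi (int k + int j - 2) *
           (2 * real n - real k - real j - 1)"
proof -
  have nz: "real n \<noteq> 0" "real n - 1 \<noteq> 0" using assms by auto
  have "real ((n - 1) * n * card (uprooted_trees n (n - k) j)) =
      real ((n - 1) ^ (n - 1 - (n - k - j)) * n ^ (n - k - j - 1) * (n + (n - k - j) - 1))"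
    using assms by (intro arg_cong[where f = real] card_uprooted_trees) auto
  moreover have "n - 1 - (n - k - j) = k + j - 1" using assms by auto
  moreover have "real (n + (n - k - j) - 1) = 2 * real n - real k - real j - 1"
    "real (n - 1) = real n - 1" using assms by (auto simp: of_nat_diff)
  ultimately have *: "(real n - 1) * real n * real (card (uprooted_trees n (n - k) j)) =
      (real n - 1) ^ (k + j - 1) * real n ^ (n - k - j - 1) * (2 * real n - real k - real j - 1)"
    by simp
  \<comment> \<open>Both integer exponents are a natural number minus one and can equal -1: the
    first when \<open>j = n - k - 1\<close>, the second when \<open>k = 0\<close> and
    \<open>j = 1\<close>. The bases are nonzero, so this is division by the base.\<close>
  have pred: "x powi (int a - 1) = x ^ a / x" if "x \<noteq> 0" for x :: real and a
    using that by (simp add: power_int_diff)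
  have "int n - int k - int j - 2 = int (n - k - j - 1) - 1" "int k + int j - 2 = int (k + j - 1) - 1"
    using assms by auto
  then have powi: "real n powi (int n - int k - int j - 2) = real n ^ (n - k - j - 1) / real n"
    "(real n - 1) powi (int k + int j - 2) = (real n - 1) ^ (k + j - 1) / (real n - 1)"
    using nz by (simp_all only: pred not_False_eq_True)
  have solve: "c = w / y * (v / x) * z" if "x * y * c = v * w * z" "x \<noteq> 0" "y \<noteq> 0"
    for c v w x y z :: real
    using that by (simp add: field_simps)
  show ?thesis unfolding powi by (rule solve[OF * nz(2,1)])
qed

end
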